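(* The linear relaxation $\mathcal{LP}(C)$ with flow constraints of the min-max shortest path problem has an integrality gap of at least $\Omega(\sqrt{n})$, even for arc series-parallel graphs. That is, there exist a constant $c>0$ and an infinite family of instances $(G,s,t,\mathcal{U})$ of the min-max shortest path problem, in which $G$ is an arc series-parallel graph with source $s$ and sink $t$ and whose number of nodes $n$ is unbounded over the family, such that every instance of the family satisfies $C^*>0$ and $$\frac{OPT}{C^*}\ \ge\ c\,\sqrt{n}.$$
   Context: Min-max shortest path problem: given a directed graph $G=(V,E)$ (parallel arcs allowed), $|V|=n$, nodes $s,t\in V$, and a finite set $\mathcal{U}$ of $K$ distinct scenarios, each scenario $\xi\in\mathcal{U}$ being a vector $(c_e^{\xi})_{e\in E}$ of nonnegative integer arc costs, let $\Phi$ be the set of (arc sets of) $s$-$t$ paths in $G$ and $$OPT=\min_{X\in\Phi}\max_{\xi\in\mathcal{U}}\sum_{e\in X}c_e^{\xi}.$$ Linear relaxation: for a parameter $C$, let $E(C)=\{e\in E: c_e^{\xi}\le C \text{ for all }\xi\in\mathcal{U}\}$. Then $\mathcal{LP}(C)$ is the following system of linear constraints in $x=(x_e)_{e\in E}$: - $\sum_{e\in E}c_e^{\xi}x_e\le C$ for all $\xi\in\mathcal{U}$; - the flow constraints $\sum_{e\in\delta^{\mathrm{out}}(v)}x_e=\sum_{e\in\delta^{\mathrm{in}}(v)}x_e$ for all $v\in V\setminus\{s,t\}$, and $\sum_{e\in\delta^{\mathrm{out}}(s)}x_e=\sum_{e\in\delta^{\mathrm{in}}(t)}x_e=1$; - $x_e\in[0,1]$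 for $e\in E(C)$, and $x_e=0$ for $e\notin E(C)$. Here $\delta^{\mathrm{out}}(v)$ and $\delta^{\mathrm{in}}(v)$ are the sets of arcs leaving and entering $v$. $C^*$ denotes the smallest value of $C$ for which $\mathcal{LP}(C)$ is feasible (so $C^*\le OPT$). The integrality gap is the supremum over instances of $OPT/C^*$. Arc series-parallel graphs (with a source and a sink) are defined recursively: a graph consisting of two nodes joined by a single arc is arc series-parallel (its source is the tail and its sink the head of the arc); if $G_1,G_2$ are arc series-parallel with sources $s_1,s_2$ and sinks $t_1,t_2$, then so are the graphs obtained by parallel composition (identify $s_1$ with $s_2$ and $t_1$ with $t_2$) and by series composition (identify $t_1$ with $s_2$; the new source is $s_1$ and the new sink is $t_2$). *)

theory Defs
  imports Complex_Main "HOL-Library.FuncSet" "Graph_Theory.Graph_Theory"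
begin

text \<open>
  Arc series-parallel graphs. The nodes identified in a composition are expressed by sharing:
  the two components have exactly the identified nodes, and no arcs, in common. As the names of
  nodes and arcs in the base case are arbitrary, this is no restriction up to renaming.
  The fields \<open>tail\<close> and \<open>head\<close> are total functions whose values outside the arc set are
  irrelevant, so \<open>compatible\<close> is not a restriction either.
\<close>

inductive arc_series_parallel :: "('a, 'b) pre_digraph \<Rightarrow> 'a \<Rightarrow> 'a \<Rightarrow> bool" where
  single: "arc_series_parallel \<lparr>verts = {u, v}, arcs = {e}, tail = ta, head = he\<rparr> u v"
    if "u \<noteq> v" "ta e = u" "he e = v"
| parallel: "arc_series_parallel (union G1 G2) s t"
    if "arc_series_parallel G1 s t" "arc_series_parallel G2 s t" "compatible G1 G2"
       "verts G1 \<inter> verts G2 = {s, t}" "arcs G1 \<inter> arcs G2 = {}"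
| series: "arc_series_parallel (union G1 G2) s t"
    if "arc_series_parallel G1 s m" "arc_series_parallel G2 m t" "compatible G1 G2"
       "verts G1 \<inter> verts G2 = {m}" "arcs G1 \<inter> arcs G2 = {}"

text \<open>
  A scenario is a vector indexed by the arcs, i.e. a function that is \<open>undefined\<close> outside the
  arc set, so that different functions are different vectors.
\<close>

locale minmax_shortest_path_instance = fin_digraph G
  for G :: "('a, 'b) pre_digraph" and s t :: 'a and U :: "('b \<Rightarrow> nat) set" +
  assumes source_in_verts: "s \<in> verts G"
    and sink_in_verts: "t \<in> verts G"
    and finite_scenarios: "finite U"
    and scenarios_nonempty: "U \<noteq> {}"
    and scenarios_vectors: "U \<subseteq> arcs G \<rightarrow>\<^sub>E UNIV"

definition path_arc_sets :: "('a, 'b) pre_digraph \<Rightarrow> 'a \<Rightarrow> 'a \<Rightarrow> 'b set set" where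
  "path_arc_sets G s t = {set p | p. pre_digraph.apath G s p t}"

definition minmax_opt :: "('a, 'b) pre_digraph \<Rightarrow> 'a \<Rightarrow> 'a \<Rightarrow> ('b \<Rightarrow> nat) set \<Rightarrow> nat" where
  "minmax_opt G s t U = (MIN X\<in>path_arc_sets G s t. MAX \<xi>\<in>U. \<Sum>e\<in>X. \<xi> e)"

definition cheap_arcs :: "('a, 'b) pre_digraph \<Rightarrow> ('b \<Rightarrow> nat) set \<Rightarrow> real \<Rightarrow> 'b set" where
  "cheap_arcs G U C = {e \<in> arcs G. \<forall>\<xi>\<in>U. real (\<xi> e) \<le> C}"

definition flow_LP ::
  "('a, 'b) pre_digraph \<Rightarrow> 'a \<Rightarrow> 'a \<Rightarrow> ('b \<Rightarrow> nat) set \<Rightarrow> real \<Rightarrow> ('b \<Rightarrow> real) set" where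
  "flow_LP G s t U C = {x.
     (\<forall>\<xi>\<in>U. (\<Sum>e\<in>arcs G. real (\<xi> e) * x e) \<le> C) \<and>
     (\<forall>v\<in>verts G - {s, t}. (\<Sum>e\<in>out_arcs G v. x e) = (\<Sum>e\<in>in_arcs G v. x e)) \<and>
     (\<Sum>e\<in>out_arcs G s. x e) = 1 \<and>
     (\<Sum>e\<in>in_arcs G t. x e) = 1 \<and>
     (\<forall>e\<in>cheap_arcs G U C. 0 \<le> x e \<and> x e \<le> 1) \<and>
     (\<forall>e\<in>arcs G - cheap_arcs G U C. x e = 0)}"

text \<open>
  \<open>C\<close> ranges over the reals; all constraints are weak inequalities, so for finite nonempty \<open>U\<close>
  the minimum is attained as soon as the system is feasible for some \<open>C\<close>.
\<close>

definition C_star :: "('a, 'b) pre_digraph \<Rightarrow> 'a \<Rightarrow> 'a \<Rightarrow> ('b \<Rightarrow> nat) set \<Rightarrow> real" where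
  "C_star G s t U = (LEAST C. flow_LP G s t U C \<noteq> {})"

end

theory Submission
  imports Defs
begin

text \<open>
  Compose \<open>m\<close> bundles of \<open>m\<close> parallel arcs each in series, and let every set of arcs containing at
  most one arc of each bundle be a scenario, with cost 1 on its arcs and 0 elsewhere. Every path
  meets all \<open>m\<close> bundles and is hit in full by some scenario, so \<open>OPT = m\<close>. The uniform flow
  with value \<open>1/m\<close> on every arc costs at most 1 in each scenario, and for \<open>C < 1\<close> no arc is
  in \<open>E(C)\<close>, so \<open>C\<^sup>* = 1\<close>. The graph has only \<open>m + 1\<close> nodes; the gap is thus even linear in the
  number of nodes, thanks to the parallel arcs.
\<close>

section \<open>Series compositions of bundles of parallel arcs\<close>

text \<open>The arcs of the \<open>i\<close>-th bundle, from node \<open>i\<close> to node \<open>Suc i\<close>, are \<open>i * k, \<dots>, i * k + (k - 1)\<close>.\<close>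

definition bundle_chain :: "nat \<Rightarrow> nat \<Rightarrow> (nat, nat) pre_digraph" where
  "bundle_chain k m =
    \<lparr>verts = {..m}, arcs = {..<m * k}, tail = \<lambda>e. e div k, head = \<lambda>e. Suc (e div k)\<rparr>"

lemma bundle_chain_simps [simp]:
  "verts (bundle_chain k m) = {..m}"
  "arcs (bundle_chain k m) = {..<m * k}"
  "tail (bundle_chain k m) e = e div k"
  "head (bundle_chain k m) e = Suc (e div k)"
  by (simp_all add: bundle_chain_def)

lemma fin_digraph_bundle_chain: "fin_digraph (bundle_chain k m)"
proof
  fix e assume e: "e \<in> arcs (bundle_chain k m)"
  then have "e div k < m"
    by (simp add: less_mult_imp_div_less)
  then show "tail (bundle_chain k m) e \<in> verts (bundle_chain k m)"
    and "head (bundle_chain k m) e \<in> verts (bundle_chain k m)"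
    by simp_all
qed simp_all

text \<open>The bundle grows by one arc at a time in parallel. The bound \<open>j \<le> k\<close>
  keeps every added arc at quotient \<open>i\<close>, so its ends are \<open>i\<close> and
  \<open>Suc i\<close>.\<close>

lemma arc_series_parallel_bundle:
  assumes "0 < j" "j \<le> k"
  shows "arc_series_parallel
    \<lparr>verts = {i, Suc i}, arcs = {i * k..<i * k + j}, tail = \<lambda>e. e div k, head = \<lambda>e. Suc (e div k)\<rparr>
    i (Suc i)"
  using assms
proof (induction j)
  case 0
  then show ?case by simp
next
  case (Suc j)
  let ?G = "\<lambda>A. \<lparr>verts = {i, Suc i}, arcs = A, tail = \<lambda>e. e div k, head = \<lambda>e. Suc (e div k)\<rparr>"
  have "(i * k + j) div k = i"
    using Suc.prems by simp
  then have single: "arc_series_parallel (?G {i * k + j}) i (Suc i)"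
    by (intro arc_series_parallel.single) simp_all
  show ?case
  \<comment> \<open>An empty bundle is not series-parallel, so the induction effectively starts with
    one arc.\<close>
  proof (cases "j = 0")
    case True
    then show ?thesis using single by simp
  next
    case False
    have "arc_series_parallel (union (?G {i * k..<i * k + j}) (?G {i * k + j})) i (Suc i)"
      using Suc False single
      by (intro arc_series_parallel.parallel) (auto simp: compatible_def)
    moreover have "union (?G {i * k..<i * k + j}) (?G {i * k + j}) = ?G {i * k..<i * k + Suc j}"
      by (auto simp: union_def)
    ultimately show ?thesis by simp
  qed
qed

text \<open>Each step appends one bundle in series; node \<open>m\<close> is the only shared node,
  and the arc ranges are adjacent.\<close>

lemma arc_series_parallel_bundle_chain:
  assumes "0 < k" "0 < m"
  shows "arc_series_parallel (bundle_chain k m) 0 m"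
  using \<open>0 < m\<close>
proof (induction m)
  case 0
  then show ?case by simp
next
  case (Suc m)
  let ?B = "\<lparr>verts = {m, Suc m}, arcs = {m * k..<m * k + k},
    tail = \<lambda>e. e div k, head = \<lambda>e. Suc (e div k)\<rparr>"
  have last: "arc_series_parallel ?B m (Suc m)"
    using arc_series_parallel_bundle[of k k m] \<open>0 < k\<close> by simp
  show ?case
  proof (cases "m = 0")
    case True
    have "?B = bundle_chain k (Suc m)"
      using True by (auto simp: bundle_chain_def)
    then show ?thesis using last True by simp
  next
    case False
    have "arc_series_parallel (union (bundle_chain k m) ?B) 0 (Suc m)"
      using Suc False last
      by (intro arc_series_parallel.series) (auto simp: compatible_def bundle_chain_def)
    moreover have "union (bundle_chain k m) ?B = bundle_chain k (Suc m)"
      by (auto simp: union_def bundle_chain_def)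
    ultimately show ?thesis by simp
  qed
qed

lemma card_bundle:
  assumes "v < m"
  shows "card {e. e < m * k \<and> e div k = v} = k"
proof (cases "k = 0")
  case False
  have "{e. e < m * k \<and> e div k = v} = {v * k..<Suc v * k}"
  proof (intro equalityI subsetI)
    fix e assume "e \<in> {v * k..<Suc v * k}"
    then have e: "v * k \<le> e" "e < Suc v * k"
      by auto
    then have "e div k = v"
      using False by (intro div_nat_eqI) (simp_all add: mult.commute)
    moreover have "e < m * k"
      using e(2) assms by (meson Suc_leI less_le_trans mult_le_mono1)
    ultimately show "e \<in> {e. e < m * k \<and> e div k = v}" by simp
  qed (use False in \<open>auto simp: dividend_less_div_times\<close>)
  then show ?thesis by simp
qed simp

text \<open>Guarantees that a path exists, so that the minimum defining OPT ranges over a nonempty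
  set.\<close>

lemma reachable_bundle_chain:
  assumes "0 < k"
  shows "0 \<rightarrow>\<^sup>*\<^bsub>bundle_chain k m\<^esub> m"
proof -
  interpret fin_digraph "bundle_chain k m"
    by (rule fin_digraph_bundle_chain)
  have "0 \<rightarrow>\<^sup>*\<^bsub>bundle_chain k m\<^esub> j" if "j \<le> m" for j
    using that
  proof (induction j)
    case 0
    then show ?case by simp
  next
    case (Suc j)
    then have "j * k \<in> arcs (bundle_chain k m)"
      using \<open>0 < k\<close> by simp
    then have "j \<rightarrow>\<^bsub>bundle_chain k m\<^esub> Suc j"
      using \<open>0 < k\<close> in_arcs_imp_in_arcs_ends by fastforce
    then show ?case
      using Suc by (meson Suc_leD reachable_adj_trans)
  qed
  then show ?thesis by simp
qed

text \<open>Every arc raises the node by exactly one, so a walk cannot skip a bundle.\<close>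

lemma tails_of_walk_bundle_chain:
  assumes "pre_digraph.cas (bundle_chain k m) u p v"
  shows "{u..<v} \<subseteq> (\<lambda>e. e div k) ` set p"
  using assms
proof (induction p arbitrary: u)
  case Nil
  then show ?case by (simp add: pre_digraph.cas.simps)
next
  case (Cons e p)
  then have "{Suc u..<v} \<subseteq> (\<lambda>e. e div k) ` set p" "e div k = u"
    by (auto simp: pre_digraph.cas.simps)
  moreover have "{u..<v} \<subseteq> insert u {Suc u..<v}"
    by auto
  ultimately show ?case by auto
qed

section \<open>Scenarios given by partial transversals\<close>

text \<open>In a chain, two arcs share a bundle iff their tails agree, so injectivity of
  \<open>tail G\<close> encodes at most one arc per bundle.\<close>

definition transversal_scenarios :: "('a, 'b) pre_digraph \<Rightarrow> ('b \<Rightarrow> nat) set" where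
  "transversal_scenarios G =
    (\<lambda>T. \<lambda>e\<in>arcs G. of_bool (e \<in> T)) ` {T. T \<subseteq> arcs G \<and> inj_on (tail G) T}"

lemma minmax_shortest_path_instance_transversal:
  assumes "fin_digraph G" "s \<in> verts G" "t \<in> verts G"
  shows "minmax_shortest_path_instance G s t (transversal_scenarios G)"
proof -
  interpret fin_digraph G by fact
  have "{} \<in> {T. T \<subseteq> arcs G \<and> inj_on (tail G) T}"
    by simp
  then show ?thesis
    using assms by unfold_locales (auto simp: transversal_scenarios_def)
qed

text \<open>Singletons are transversals. This is what empties E(C) for \<open>C < 1\<close>.\<close>

lemma transversal_scenario_arc:
  assumes "e \<in> arcs G"
  obtains \<xi> where "\<xi> \<in> transversal_scenarios G" "\<xi> e = 1"
proof
  show "(\<lambda>e'\<in>arcs G. of_bool (e' \<in> {e})) \<in> transversal_scenarios G"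
    unfolding transversal_scenarios_def using assms by (intro imageI) simp
qed (use assms in simp)

lemma sum_transversal_scenario_le:
  assumes "fin_digraph G" "\<xi> \<in> transversal_scenarios G"
  shows "(\<Sum>e\<in>arcs G. \<xi> e) \<le> card (tail G ` arcs G)"
proof -
  interpret fin_digraph G by fact
  obtain T where T: "T \<subseteq> arcs G" "inj_on (tail G) T"
    and \<xi>: "\<xi> = (\<lambda>e\<in>arcs G. of_bool (e \<in> T))"
    using assms(2) by (auto simp: transversal_scenarios_def)
  have "(\<Sum>e\<in>arcs G. \<xi> e) = card T"
    using T(1) by (simp add: \<xi> Int_absorb1)
  also have "\<dots> = card (tail G ` T)"
    using T(2) by (simp add: card_image)
  also have "\<dots> \<le> card (tail G ` arcs G)"
    using T(1) by (intro card_mono) auto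
  finally show ?thesis .
qed

text \<open>One representative arc of \<open>X\<close> per tail forms a transversal, and its
  scenario charges each representative 1.\<close>

lemma transversal_scenario_cost_ge:
  assumes "fin_digraph G" "X \<subseteq> arcs G"
  obtains \<xi> where "\<xi> \<in> transversal_scenarios G" "card (tail G ` X) \<le> (\<Sum>e\<in>X. \<xi> e)"
proof -
  interpret fin_digraph G by fact
  obtain T where T: "T \<subseteq> X" "inj_on (tail G) T" "tail G ` X = tail G ` T"
    by (metis subset_image_inj subset_refl)
  let ?\<xi> = "\<lambda>e\<in>arcs G. of_bool (e \<in> T)"
  have fin: "finite X"
    using assms(2) finite_arcs finite_subset by blast
  have "(\<Sum>e\<in>X. ?\<xi> e) = (\<Sum>e\<in>X. of_bool (e \<in> T))"
    using assms(2) by (intro sum.cong) auto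
  also have "\<dots> = card T"
    using T(1) fin by (simp add: Int_absorb1)
  finally have "card (tail G ` X) \<le> (\<Sum>e\<in>X. ?\<xi> e)"
    using T(2,3) by (simp add: card_image)
  moreover have "?\<xi> \<in> transversal_scenarios G"
    unfolding transversal_scenarios_def using T assms(2) by (intro imageI) auto
  ultimately show ?thesis
    by (rule that[rotated])
qed

section \<open>The gap of the instances\<close>

lemma minmax_opt_bundle_chain_ge:
  assumes "0 < k"
  shows "m \<le> minmax_opt (bundle_chain k m) 0 m (transversal_scenarios (bundle_chain k m))"
proof -
  let ?G = "bundle_chain k m"
  let ?U = "transversal_scenarios ?G"
  interpret minmax_shortest_path_instance ?G 0 m ?U
    by (simp add: minmax_shortest_path_instance_transversal fin_digraph_bundle_chain)
  have fin: "finite (path_arc_sets ?G 0 m)"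
    using apaths_finite[of 0 m] by (simp add: path_arc_sets_def)
  have ne: "path_arc_sets ?G 0 m \<noteq> {}"
    using reachable_bundle_chain[OF assms, of m] by (auto simp: path_arc_sets_def reachable_apath)
  have "m \<le> (MAX \<xi>\<in>?U. \<Sum>e\<in>X. \<xi> e)" if path: "X \<in> path_arc_sets ?G 0 m" for X
  proof -
    obtain p where p: "apath 0 p m" and X: "X = set p"
      using path by (auto simp: path_arc_sets_def)
    have arcs: "X \<subseteq> arcs ?G" and cas: "cas 0 p m"
      using p by (auto simp: X apath_def awalk_def)
    have "{0..<m} \<subseteq> tail ?G ` X"
      using tails_of_walk_bundle_chain[OF cas] by (simp add: X)
    then have "m \<le> card (tail ?G ` X)"
      using card_mono[of "tail ?G ` X" "{0..<m}"] by (simp add: X)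
    also obtain \<xi> where \<xi>: "\<xi> \<in> ?U" "card (tail ?G ` X) \<le> (\<Sum>e\<in>X. \<xi> e)"
      using transversal_scenario_cost_ge[OF fin_digraph_axioms arcs] .
    note \<xi>(2)
    also have "(\<Sum>e\<in>X. \<xi> e) \<le> (MAX \<xi>\<in>?U. \<Sum>e\<in>X. \<xi> e)"
      using \<xi>(1) finite_scenarios by (intro Max_ge) auto
    finally show ?thesis .
  qed
  then show ?thesis
    using fin ne by (auto simp: minmax_opt_def)
qed

text \<open>Bundle width equals chain length here: a scenario charges at most \<open>m\<close> arcs,
  each carrying \<open>1 / m\<close>, while the \<open>m\<close> arcs of a bundle together carry one
  unit.\<close>

lemma uniform_flow_feasible:
  assumes "0 < m"
  shows "(\<lambda>e. 1 / real m) \<in>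
    flow_LP (bundle_chain m m) 0 m (transversal_scenarios (bundle_chain m m)) 1"
proof -
  let ?G = "bundle_chain m m"
  let ?U = "transversal_scenarios ?G"
  have scenario: "(\<Sum>e\<in>arcs ?G. real (\<xi> e) * (1 / real m)) \<le> 1" if "\<xi> \<in> ?U" for \<xi>
  proof -
    have "tail ?G ` arcs ?G \<subseteq> {..<m}"
      by (auto simp: less_mult_imp_div_less)
    then have "card (tail ?G ` arcs ?G) \<le> m"
      using card_mono[of "{..<m}" "tail ?G ` arcs ?G"] by simp
    then have "(\<Sum>e\<in>arcs ?G. \<xi> e) \<le> m"
      using sum_transversal_scenario_le[OF fin_digraph_bundle_chain that] by (rule le_trans[rotated])
    then have "real (\<Sum>e\<in>arcs ?G. \<xi> e) \<le> real m"
      by (rule of_nat_mono)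
    moreover have "(\<Sum>e\<in>arcs ?G. real (\<xi> e) * (1 / real m)) = real (\<Sum>e\<in>arcs ?G. \<xi> e) / real m"
      by (simp only: of_nat_sum sum_divide_distrib times_divide_eq_right mult_1_right)
    ultimately show ?thesis
      using assms by (simp add: divide_le_eq_1)
  qed
  have out: "(\<Sum>e\<in>out_arcs ?G v. 1 / real m) = 1" if "v < m" for v
    using card_bundle[OF that, of m] assms by (simp add: out_arcs_def)
  have "in_arcs ?G (Suc v) = {e. e < m * m \<and> e div m = v}" for v
    by (auto simp: in_arcs_def)
  then have into: "(\<Sum>e\<in>in_arcs ?G (Suc v). 1 / real m) = 1" if "v < m" for v
    using card_bundle[OF that, of m] assms by simp
  \<comment> \<open>All costs are 0 or 1, so the threshold 1 excludes no arc.\<close>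
  have cheap: "cheap_arcs ?G ?U 1 = arcs ?G"
    by (auto simp: cheap_arcs_def transversal_scenarios_def)
  \<comment> \<open>An inner node satisfies \<open>0 < v < m\<close>; its entering arcs are bundle
    \<open>v - 1\<close> and its leaving arcs are bundle \<open>v\<close>.\<close>
  have "(\<Sum>e\<in>out_arcs ?G v. 1 / real m) = (\<Sum>e\<in>in_arcs ?G v. 1 / real m)"
    if "v \<in> verts ?G - {0, m}" for v
    using that out[of v] into[of "v - 1"] by auto
  then show ?thesis
    using scenario out[of 0] into[of "m - 1"] assms by (simp add: flow_LP_def cheap)
qed

text \<open>With every arc excluded, \<open>x\<close> vanishes on all arcs, contradicting the unit
  outflow at \<open>s\<close>. The shape of the graph does not matter.\<close>

lemma flow_LP_transversal_infeasible:
  assumes "C < 1"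
  shows "flow_LP G s t (transversal_scenarios G) C = {}"
proof -
  have cheap: "cheap_arcs G (transversal_scenarios G) C = {}"
  proof -
    have "e \<notin> cheap_arcs G (transversal_scenarios G) C" if e: "e \<in> arcs G" for e
    proof -
      obtain \<xi> where "\<xi> \<in> transversal_scenarios G" "\<xi> e = 1"
        using e by (rule transversal_scenario_arc)
      then show ?thesis
        using assms by (force simp: cheap_arcs_def)
    qed
    then show ?thesis
      by (auto simp: cheap_arcs_def)
  qed
  have False if x: "x \<in> flow_LP G s t (transversal_scenarios G) C" for x
  proof -
    have "(\<Sum>e\<in>out_arcs G s. x e) = 1"
      using x unfolding flow_LP_def by blast
    moreover have "(\<Sum>e\<in>out_arcs G s. x e) = 0"
      using x by (intro sum.neutral) (simp add: flow_LP_def cheap)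
    ultimately show False by simp
  qed
  then show ?thesis by blast
qed

lemma C_star_bundle_chain:
  assumes "0 < m"
  shows "C_star (bundle_chain m m) 0 m (transversal_scenarios (bundle_chain m m)) = 1"
  unfolding C_star_def
proof (rule Least_equality)
  show "flow_LP (bundle_chain m m) 0 m (transversal_scenarios (bundle_chain m m)) 1 \<noteq> {}"
    using uniform_flow_feasible[OF assms] by blast
next
  fix C
  assume "flow_LP (bundle_chain m m) 0 m (transversal_scenarios (bundle_chain m m)) C \<noteq> {}"
  then show "1 \<le> C"
    using flow_LP_transversal_infeasible by (metis not_le)
qed

text \<open>Converts the linear gap \<open>m\<close> on \<open>m + 1\<close> nodes into the
  square-root bound; the factor \<open>1 / 2\<close> makes it hold from \<open>m = 1\<close>
  on.\<close>

lemma half_sqrt_Suc_le: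
  assumes "0 < m"
  shows "1 / 2 * sqrt (real (Suc m)) \<le> real m"
proof -
  have "Suc m \<le> 2 * m"
    using assms by simp
  also have "\<dots> \<le> (2 * m)\<^sup>2"
    by (simp add: power2_eq_square)
  finally have "real (Suc m) \<le> (2 * real m)\<^sup>2"
    by (metis of_nat_le_iff of_nat_mult of_nat_numeral of_nat_power)
  then have "sqrt (real (Suc m)) \<le> 2 * real m"
    by (intro real_le_lsqrt) simp_all
  then show ?thesis by simp
qed

theorem proposition1:
  shows "\<exists>c::real. c > 0 \<and>
    (\<exists>F :: ((nat, nat) pre_digraph \<times> nat \<times> nat \<times> (nat \<Rightarrow> nat) set) set.
       infinite F \<and>
       (\<forall>(G, s, t, U)\<in>F.
          minmax_shortest_path_instance G s t U \<and>
          arc_series_parallel G s t \<and>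
          C_star G s t U > 0 \<and>
          real (minmax_opt G s t U) / C_star G s t U \<ge> c * sqrt (real (card (verts G)))) \<and>
       (\<forall>N::nat. \<exists>(G, s, t, U)\<in>F. card (verts G) \<ge> N))"
proof (intro exI conjI)
  let ?inst = "\<lambda>m. (bundle_chain m m, 0::nat, m, transversal_scenarios (bundle_chain m m))"
  let ?F = "?inst ` {0<..}"
  show "(1 / 2 :: real) > 0" by simp
  \<comment> \<open>The sink \<open>m\<close> is a component of the instance, so distinct
    \<open>m\<close> give distinct instances.\<close>
  show "infinite ?F"
    by (subst finite_image_iff) (auto simp: inj_on_def infinite_Ioi)
  show "\<forall>(G, s, t, U)\<in>?F.
      minmax_shortest_path_instance G s t U \<and>
      arc_series_parallel G s t \<and>
      C_star G s t U > 0 \<and>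
      real (minmax_opt G s t U) / C_star G s t U \<ge> 1 / 2 * sqrt (real (card (verts G)))"
  proof safe
    fix m :: nat assume "0 < m"
    let ?G = "bundle_chain m m"
    let ?U = "transversal_scenarios ?G"
    show "minmax_shortest_path_instance ?G 0 m ?U"
      by (simp add: minmax_shortest_path_instance_transversal fin_digraph_bundle_chain)
    show "arc_series_parallel ?G 0 m"
      using \<open>0 < m\<close> by (intro arc_series_parallel_bundle_chain)
    show "C_star ?G 0 m ?U > 0"
      using \<open>0 < m\<close> by (simp add: C_star_bundle_chain)
    have "1 / 2 * sqrt (real (card (verts ?G))) \<le> real m"
      using half_sqrt_Suc_le[OF \<open>0 < m\<close>] by simp
    also have "\<dots> \<le> real (minmax_opt ?G 0 m ?U)"
      using minmax_opt_bundle_chain_ge[OF \<open>0 < m\<close>] by simp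
    finally show "real (minmax_opt ?G 0 m ?U) / C_star ?G 0 m ?U
        \<ge> 1 / 2 * sqrt (real (card (verts ?G)))"
      using \<open>0 < m\<close> by (simp add: C_star_bundle_chain)
  qed
  show "\<forall>N::nat. \<exists>(G, s, t, U)\<in>?F. card (verts G) \<ge> N"
  proof
    fix N :: nat
    \<comment> \<open>\<open>Suc N\<close> is positive even for \<open>N = 0\<close>, and the
      instance has \<open>N + 2\<close> nodes.\<close>
    have "?inst (Suc N) \<in> ?F"
      by (intro imageI) simp
    then show "\<exists>(G, s, t, U)\<in>?F. card (verts G) \<ge> N"
      by (rule rev_bexI) simp
  qed
qed

end
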